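(* Every subring of $\mathbb{Q}$ (endowed with the natural ordering) is po-coherent.
   Context: Rings are associative and unital, and subrings contain $1$. A po-ring is a ring $R$ with a partial ordering $\leq$ such that: $x\leq y$ implies $x+z\leq y+z$, and, if $z\geq 0$, also $xz\leq yz$ and $zx\leq zy$; $R$ is directed, i.e. $R=R^++(-R^+)$ where $R^+=\{x\in R: x\geq 0\}$; and $0\leq 1$. Every totally ordered ring is a po-ring. A right $R^+$-subsemimodule of a right $R$-module is an additive submonoid closed under right multiplication by scalars in $R^+$; it is finitely generated if it consists of all right linear combinations, with coefficients in $R^+$, of some finite subset of itself. A po-ring $R$ is right po-coherent if for every integer $n\geq 1$ and every $1\times n$ row matrix $U$ with entries in $R$, the set of all $n\times 1$ column matrices $X$ with entries in $R$ such that $UX\geq 0$ and $X\geq 0$ (entrywise) is a finitely generated right $R^+$-subsemimodule of the right $R$-module of $n\times 1$ columns over $R$. Left po-coherence is defined symmetrically, and $R$ is po-coherent if it is both right and left po-coherent. *)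

theory Defs
  imports Complex_Main "HOL-Algebra.Subrings"
begin

record 'a po_ring = "'a ring" +
  ple :: "['a, 'a] \<Rightarrow> bool" (infixl "\<preceq>\<index>" 50)

definition nonneg :: "('a, 'b) po_ring_scheme \<Rightarrow> 'a set"
  where "nonneg R = {x \<in> carrier R. \<zero>\<^bsub>R\<^esub> \<preceq>\<^bsub>R\<^esub> x}"

locale po_ring = ring R for R :: "('a, 'b) po_ring_scheme" (structure) +
  assumes ple_refl: "x \<in> carrier R \<Longrightarrow> x \<preceq> x"
    and ple_antisym:
      "\<lbrakk>x \<preceq> y; y \<preceq> x; x \<in> carrier R; y \<in> carrier R\<rbrakk> \<Longrightarrow> x = y"
    and ple_trans:
      "\<lbrakk>x \<preceq> y; y \<preceq> z; x \<in> carrier R; y \<in> carrier R; z \<in> carrier R\<rbrakk> \<Longrightarrow> x \<preceq> z"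
    and ple_add_mono:
      "\<lbrakk>x \<preceq> y; x \<in> carrier R; y \<in> carrier R; z \<in> carrier R\<rbrakk> \<Longrightarrow> x \<oplus> z \<preceq> y \<oplus> z"
    and ple_mult_right_mono:
      "\<lbrakk>x \<preceq> y; x \<in> carrier R; y \<in> carrier R; z \<in> nonneg R\<rbrakk> \<Longrightarrow> x \<otimes> z \<preceq> y \<otimes> z"
    and ple_mult_left_mono:
      "\<lbrakk>x \<preceq> y; x \<in> carrier R; y \<in> carrier R; z \<in> nonneg R\<rbrakk> \<Longrightarrow> z \<otimes> x \<preceq> z \<otimes> y"
    and directed: "x \<in> carrier R \<Longrightarrow> \<exists>a\<in>nonneg R. \<exists>b\<in>nonneg R. x = a \<oplus> (\<ominus> b)"
    and zero_ple_one: "\<zero> \<preceq> \<one>"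

text \<open>
  Both the n by 1 columns and the 1 by n rows over R are represented by the
  functions from \<open>{..<n}\<close> to the carrier that are \<open>undefined\<close> outside \<open>{..<n}\<close>;
  whether such a function is a row or a column is determined by the side on
  which scalars act.
\<close>

definition vecs :: "('a, 'b) po_ring_scheme \<Rightarrow> nat \<Rightarrow> (nat \<Rightarrow> 'a) set"
  where "vecs R n = {..<n} \<rightarrow>\<^sub>E carrier R"

definition row_col_mult ::
    "('a, 'b) po_ring_scheme \<Rightarrow> nat \<Rightarrow> (nat \<Rightarrow> 'a) \<Rightarrow> (nat \<Rightarrow> 'a) \<Rightarrow> 'a"
  where "row_col_mult R n U X = (\<Oplus>\<^bsub>R\<^esub>i\<in>{..<n}. U i \<otimes>\<^bsub>R\<^esub> X i)"

definition add_submonoid :: "('a, 'b) po_ring_scheme \<Rightarrow> nat \<Rightarrow> (nat \<Rightarrow> 'a) set \<Rightarrow> bool"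
  where "add_submonoid R n M \<longleftrightarrow>
    M \<subseteq> vecs R n \<and>
    (\<lambda>i\<in>{..<n}. \<zero>\<^bsub>R\<^esub>) \<in> M \<and>
    (\<forall>X\<in>M. \<forall>Y\<in>M. (\<lambda>i\<in>{..<n}. X i \<oplus>\<^bsub>R\<^esub> Y i) \<in> M)"

definition right_subsemimodule ::
    "('a, 'b) po_ring_scheme \<Rightarrow> nat \<Rightarrow> (nat \<Rightarrow> 'a) set \<Rightarrow> bool"
  where "right_subsemimodule R n M \<longleftrightarrow>
    add_submonoid R n M \<and>
    (\<forall>X\<in>M. \<forall>c\<in>nonneg R. (\<lambda>i\<in>{..<n}. X i \<otimes>\<^bsub>R\<^esub> c) \<in> M)"

definition left_subsemimodule ::
    "('a, 'b) po_ring_scheme \<Rightarrow> nat \<Rightarrow> (nat \<Rightarrow> 'a) set \<Rightarrow> bool"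
  where "left_subsemimodule R n M \<longleftrightarrow>
    add_submonoid R n M \<and>
    (\<forall>X\<in>M. \<forall>c\<in>nonneg R. (\<lambda>i\<in>{..<n}. c \<otimes>\<^bsub>R\<^esub> X i) \<in> M)"

definition right_combinations ::
    "('a, 'b) po_ring_scheme \<Rightarrow> nat \<Rightarrow> (nat \<Rightarrow> 'a) set \<Rightarrow> (nat \<Rightarrow> 'a) set"
  where "right_combinations R n G =
    {\<lambda>i\<in>{..<n}. \<Oplus>\<^bsub>R\<^esub>g\<in>G. g i \<otimes>\<^bsub>R\<^esub> c g | c. c \<in> G \<rightarrow> nonneg R}"

definition left_combinations ::
    "('a, 'b) po_ring_scheme \<Rightarrow> nat \<Rightarrow> (nat \<Rightarrow> 'a) set \<Rightarrow> (nat \<Rightarrow> 'a) set"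
  where "left_combinations R n G =
    {\<lambda>i\<in>{..<n}. \<Oplus>\<^bsub>R\<^esub>g\<in>G. c g \<otimes>\<^bsub>R\<^esub> g i | c. c \<in> G \<rightarrow> nonneg R}"

definition fg_right_subsemimodule ::
    "('a, 'b) po_ring_scheme \<Rightarrow> nat \<Rightarrow> (nat \<Rightarrow> 'a) set \<Rightarrow> bool"
  where "fg_right_subsemimodule R n M \<longleftrightarrow>
    right_subsemimodule R n M \<and>
    (\<exists>G. finite G \<and> G \<subseteq> M \<and> M = right_combinations R n G)"

definition fg_left_subsemimodule ::
    "('a, 'b) po_ring_scheme \<Rightarrow> nat \<Rightarrow> (nat \<Rightarrow> 'a) set \<Rightarrow> bool"
  where "fg_left_subsemimodule R n M \<longleftrightarrow>
    left_subsemimodule R n M \<and>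
    (\<exists>G. finite G \<and> G \<subseteq> M \<and> M = left_combinations R n G)"

definition right_po_coherent :: "('a, 'b) po_ring_scheme \<Rightarrow> bool"
  where "right_po_coherent R \<longleftrightarrow> po_ring R \<and>
    (\<forall>n\<ge>1. \<forall>U\<in>vecs R n.
      fg_right_subsemimodule R n
        {X \<in> vecs R n. \<zero>\<^bsub>R\<^esub> \<preceq>\<^bsub>R\<^esub> row_col_mult R n U X \<and> (\<forall>i<n. \<zero>\<^bsub>R\<^esub> \<preceq>\<^bsub>R\<^esub> X i)})"

definition left_po_coherent :: "('a, 'b) po_ring_scheme \<Rightarrow> bool"
  where "left_po_coherent R \<longleftrightarrow> po_ring R \<and>
    (\<forall>n\<ge>1. \<forall>U\<in>vecs R n.
      fg_left_subsemimodule R n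
        {X \<in> vecs R n. \<zero>\<^bsub>R\<^esub> \<preceq>\<^bsub>R\<^esub> row_col_mult R n X U \<and> (\<forall>i<n. \<zero>\<^bsub>R\<^esub> \<preceq>\<^bsub>R\<^esub> X i)})"

definition po_coherent :: "('a, 'b) po_ring_scheme \<Rightarrow> bool"
  where "po_coherent R \<longleftrightarrow> right_po_coherent R \<and> left_po_coherent R"

definition rat_po_ring :: "rat po_ring"
  where "rat_po_ring =
    \<lparr>carrier = UNIV, mult = (*), one = 1, zero = 0, add = (+), ple = (\<le>)\<rparr>"

end

theory Submission
  imports Defs
begin

text \<open>
  A vector with entries in a subring \<open>S\<close> of the rationals is an integer vector divided by a common
  denominator \<open>d\<close>, and \<open>1/d\<close> lies in \<open>S\<close> by Bezout. Hence it suffices to generate, as a monoid, the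
  nonnegative integer vectors \<open>y\<close> with \<open>u \<cdot> y \<ge> 0\<close>, where \<open>u\<close> may be taken integral (Gordan's lemma for
  one inequality). If such a \<open>y\<close> has a very large entry, one can subtract from it a unit vector
  \<open>e\<^sub>k\<close> with \<open>u\<^sub>k \<ge> 0\<close> or a vector \<open>(- u\<^sub>j) e\<^sub>i + u\<^sub>i e\<^sub>j\<close> with \<open>u\<^sub>i > 0 > u\<^sub>j\<close>, and stay in the
  set; so the elements with bounded entries generate.
\<close>

section \<open>Gordan's lemma for one integer inequality\<close>

definition int_cone :: "'a set \<Rightarrow> ('a \<Rightarrow> int) \<Rightarrow> ('a \<Rightarrow> int) set"
  where "int_cone I u = {y. (\<forall>i\<in>I. 0 \<le> y i) \<and> 0 \<le> (\<Sum>i\<in>I. u i * y i)}"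

lemma sum_unit_vector:
  fixes u :: "'a \<Rightarrow> int"
  assumes "finite I" "k \<in> I"
  shows "(\<Sum>i\<in>I. u i * (\<lambda>i\<in>I. if i = k then 1 else 0) i) = u k"
proof -
  have "(\<Sum>i\<in>I. u i * (\<lambda>i\<in>I. if i = k then 1 else 0) i) = (\<Sum>i\<in>I. if i = k then u i else 0)"
    by (rule sum.cong) auto
  then show ?thesis
    using assms by simp
qed

text \<open>The contributions \<open>- u p * u q\<close> and \<open>u q * u p\<close> cancel, so
  subtracting such a vector leaves the value of the linear form unchanged.\<close>

lemma sum_pair_vector:
  fixes u :: "'a \<Rightarrow> int"
  assumes "finite I" "p \<in> I" "q \<in> I" "p \<noteq> q"
  shows "(\<Sum>i\<in>I. u i * (\<lambda>i\<in>I. if i = p then - u q else if i = q then u p else 0) i) = 0"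
proof -
  have "(\<Sum>i\<in>I. u i * (\<lambda>i\<in>I. if i = p then - u q else if i = q then u p else 0) i)
      = (\<Sum>i\<in>I. (if i = p then - (u p * u q) else 0) + (if i = q then u p * u q else 0))"
    using assms by (intro sum.cong) (auto simp: mult.commute)
  also have "\<dots> = 0"
    using assms by (simp add: sum.distrib)
  finally show ?thesis .
qed

text \<open>This is the descent step: the last two bounds on \<open>g\<close> keep
  \<open>y - g\<close> in the cone. The size of \<open>K\<close> lets a single entry above
  \<open>K\<close> outweigh all terms of opposite sign, as soon as each of those is at most
  \<open>B * B\<close> in absolute value.\<close>

lemma int_cone_reduction:
  fixes I :: "'a set" and u y :: "'a \<Rightarrow> int" and B :: int
  defines "K \<equiv> int (card I) * B * B + B"
  assumes I: "finite I" and B: "\<And>i. i \<in> I \<Longrightarrow> \<bar>u i\<bar> \<le> B" and B1: "1 \<le> B"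
    and y: "y \<in> int_cone I u" and k: "k \<in> I" "K < y k"
  shows "\<exists>g \<in> int_cone I u \<inter> (I \<rightarrow>\<^sub>E {0..K}).
    (\<exists>i\<in>I. g i \<noteq> 0) \<and> (\<forall>i\<in>I. g i \<le> y i) \<and> (\<Sum>i\<in>I. u i * g i) \<le> (\<Sum>i\<in>I. u i * y i)"
proof -
  have y0: "\<And>i. i \<in> I \<Longrightarrow> 0 \<le> y i" and uy: "0 \<le> (\<Sum>i\<in>I. u i * y i)"
    using y by (auto simp: int_cone_def)
  have BK: "B \<le> K"
    using B1 by (simp add: K_def)
  \<comment> \<open>The first condition puts the unit vector at \<open>k\<close> in the cone, the
    second keeps the remainder there.\<close>
  have unit: ?thesis if "0 \<le> u k" "u k \<le> (\<Sum>i\<in>I. u i * y i)"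
  proof -
    let ?g = "\<lambda>i\<in>I. if i = k then 1 else 0 :: int"
    have "(\<Sum>i\<in>I. u i * ?g i) = u k"
      using I k(1) by (rule sum_unit_vector)
    moreover from this have "?g \<in> int_cone I u"
      using that(1) by (simp add: int_cone_def)
    moreover have "?g \<in> I \<rightarrow>\<^sub>E {0..K}" "\<forall>i\<in>I. ?g i \<le> y i" "?g k \<noteq> 0"
      using BK B1 k y0 by auto
    ultimately show ?thesis
      using that k by (intro bexI[of _ ?g]) auto
  qed
  have pair: ?thesis
    if "p \<in> I" "q \<in> I" "0 < u p" "u q < 0" "- u q \<le> y p" "u p \<le> y q" for p q
  proof -
    let ?g = "\<lambda>i\<in>I. if i = p then - u q else if i = q then u p else 0"
    have 0: "(\<Sum>i\<in>I. u i * ?g i) = 0"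
      using that by (intro sum_pair_vector I) auto
    have 1: "?g \<in> I \<rightarrow>\<^sub>E {0..K}"
      using that BK B1 B[of p] B[of q] by (auto simp: PiE_iff extensional_def)
    then have "?g \<in> int_cone I u"
      using 0 unfolding int_cone_def PiE_iff by auto
    moreover have "\<forall>i\<in>I. ?g i \<le> y i" "?g p \<noteq> 0"
      using that y0 by auto
    ultimately show ?thesis
      using 0 1 uy that(1) by (intro bexI[of _ ?g]) auto
  qed
  \<comment> \<open>For \<open>u k\<close> nonzero, look for an index of opposite sign whose entry
    is large enough to subtract a pair vector. If there is none, all entries of opposite sign are
    below \<open>B\<close>: for positive \<open>u k\<close> the unit vector can then be subtracted,
    and for negative \<open>u k\<close> the whole sum would be negative.\<close>
  consider "u k = 0"
    | j where "0 < u k" "j \<in> I" "u j < 0" "u k \<le> y j"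
    | "0 < u k" "\<And>j. j \<in> I \<Longrightarrow> u j < 0 \<Longrightarrow> y j < u k"
    | j where "u k < 0" "j \<in> I" "0 < u j" "- u k \<le> y j"
    | "u k < 0" "\<And>j. j \<in> I \<Longrightarrow> 0 < u j \<Longrightarrow> y j < - u k"
    by (metis linorder_neqE not_le)
  then show ?thesis
  proof cases
    case 1
    then show ?thesis using unit uy by simp
  next
    case (2 j)
    then show ?thesis using pair[of k j] k BK B[of j] by auto
  next
    case 3
    have "- (B * B) \<le> u j * y j" if j: "j \<in> I" for j
    proof (cases "u j < 0")
      case True
      then have "y j \<le> B"
        using 3(2)[OF j] B[OF k(1)] by linarith
      then have "- u j * y j \<le> B * B"
        using B[OF j] B1 True y0[OF j] by (intro mult_mono) auto
      then show ?thesis by simp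
    next
      case False
      then have "0 \<le> u j * y j" using y0[OF j] by simp
      then show ?thesis using B1 by (smt (verit) mult_nonneg_nonneg)
    qed
    then have "(\<Sum>i\<in>I-{k}. - (B * B)) \<le> (\<Sum>i\<in>I-{k}. u i * y i)"
      by (intro sum_mono) auto
    moreover have "- (int (card I) * B * B) \<le> (\<Sum>i\<in>I-{k}. - (B * B))"
      using I B1 card_Diff1_le[of I k] by (simp add: mult_right_mono algebra_simps)
    ultimately have "- (int (card I) * B * B) \<le> (\<Sum>i\<in>I-{k}. u i * y i)"
      by (rule order_trans[rotated])
    \<comment> \<open>Integrality turns \<open>K < y k\<close> into \<open>K \<le> y k - 1\<close>;
      the spare \<open>u k\<close> is exactly what the unit vector removes from the sum.\<close>
    moreover have "u k * K \<le> u k * (y k - 1)"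
      using 3(1) k(2) by (intro mult_left_mono) auto
    moreover have "1 * K \<le> u k * K"
      using 3(1) BK B1 by (intro mult_right_mono) auto
    ultimately have "u k \<le> u k * y k + (\<Sum>i\<in>I-{k}. u i * y i)"
      using B1 unfolding K_def by (simp add: right_diff_distrib)
    then show ?thesis
      using unit 3(1) I k(1) by (simp add: sum.remove)
  next
    case (4 j)
    then show ?thesis using pair[of j k] k BK B[of j] by auto
  next
    case 5
    have "u j * y j \<le> B * B" if j: "j \<in> I" for j
    proof (cases "0 < u j")
      case True
      then have "y j \<le> B"
        using 5(2)[OF j] B[OF k(1)] by linarith
      then show ?thesis
        using B[OF j] B1 True y0[OF j] by (intro mult_mono) auto
    next
      case False
      then have "u j * y j \<le> 0" using y0[OF j] by (simp add: mult_nonpos_nonneg)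
      then show ?thesis using B1 by (smt (verit) mult_nonneg_nonneg)
    qed
    then have "(\<Sum>i\<in>I-{k}. u i * y i) \<le> (\<Sum>i\<in>I-{k}. B * B)"
      by (intro sum_mono) auto
    moreover have "(\<Sum>i\<in>I-{k}. B * B) \<le> int (card I) * B * B"
      using I B1 card_Diff1_le[of I k] by (simp add: mult_right_mono algebra_simps)
    ultimately have "(\<Sum>i\<in>I-{k}. u i * y i) \<le> int (card I) * B * B"
      by (rule order_trans)
    \<comment> \<open>Integrality gives \<open>u k \<le> - 1\<close>, so the term at
      \<open>k\<close> lies below \<open>- K\<close> and outweighs the rest. This contradicts
      \<open>y\<close> being in the cone.\<close>
    moreover have "u k * y k \<le> - 1 * y k"
      using 5(1) y0[OF k(1)] by (intro mult_right_mono) auto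
    ultimately have "u k * y k + (\<Sum>i\<in>I-{k}. u i * y i) < 0"
      using k B1 by (simp add: K_def)
    then show ?thesis
      using uy I k(1) by (simp add: sum.remove)
  qed
qed

text \<open>The generators are the cone elements in a finite box. An element with all entries at
  most \<open>K\<close> is its own generator; from any other, \<open>int_cone_reduction\<close>
  splits off a nonzero generator, and strong induction on the sum of the entries finishes.\<close>

lemma int_cone_finitely_generated:
  assumes I: "finite I"
  obtains G where "finite G" "G \<subseteq> int_cone I u \<inter> extensional I"
    "\<And>y. y \<in> int_cone I u \<Longrightarrow> \<exists>c :: _ \<Rightarrow> nat. \<forall>i\<in>I. y i = (\<Sum>g\<in>G. int (c g) * g i)"
proof -
  \<comment> \<open>The sum dominates every coefficient; the added 1 secures
    \<open>1 \<le> B\<close> even when all coefficients vanish.\<close>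
  define B where "B = 1 + (\<Sum>i\<in>I. \<bar>u i\<bar>)"
  have B: "\<bar>u i\<bar> \<le> B" if "i \<in> I" for i
    using member_le_sum[of i I "\<lambda>i. \<bar>u i\<bar>"] that I by (simp add: B_def)
  have B1: "1 \<le> B"
    by (simp add: B_def sum_nonneg)
  define K where "K = int (card I) * B * B + B"
  define G where "G = int_cone I u \<inter> (I \<rightarrow>\<^sub>E {0..K})"
  have finG: "finite G"
    unfolding G_def by (rule finite_Int, rule disjI2, rule finite_PiE[OF I]) simp
  have gen: "\<exists>c :: _ \<Rightarrow> nat. \<forall>i\<in>I. y i = (\<Sum>g\<in>G. int (c g) * g i)" if "y \<in> int_cone I u" for y
    using that
  proof (induction "nat (\<Sum>i\<in>I. y i)" arbitrary: y rule: less_induct)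
    case less
    have y0: "\<And>i. i \<in> I \<Longrightarrow> 0 \<le> y i"
      using less.prems by (auto simp: int_cone_def)
    show ?case
    proof (cases "\<forall>i\<in>I. y i \<le> K")
      case True
      \<comment> \<open>Cone elements are arbitrary outside \<open>I\<close>, but those in
        \<open>G\<close> are extensional; the restriction picks the representative in
        \<open>G\<close>.\<close>
      define h where "h = restrict y I"
      have "h \<in> G"
        using True less.prems by (auto simp: h_def G_def int_cone_def)
      have "y i = (\<Sum>g\<in>G. int (if g = h then 1 else 0) * g i)" if "i \<in> I" for i
      proof -
        have "(\<Sum>g\<in>G. int (if g = h then 1 else 0) * g i) = (\<Sum>g\<in>G. if g = h then g i else 0)"
          by (rule sum.cong) auto
        then show ?thesis
          using \<open>h \<in> G\<close> finG that by (simp add: h_def)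
      qed
      then show ?thesis
        by (intro exI[of _ "\<lambda>g. if g = h then 1 else 0"] ballI)
    next
      case False
      then obtain k where "k \<in> I" "K < y k" by force
      then obtain h where h: "h \<in> G" "\<exists>i\<in>I. h i \<noteq> 0" "\<forall>i\<in>I. h i \<le> y i"
        "(\<Sum>i\<in>I. u i * h i) \<le> (\<Sum>i\<in>I. u i * y i)"
        using int_cone_reduction[OF I B B1 less.prems, of k] unfolding K_def G_def by blast
      have h0: "\<And>i. i \<in> I \<Longrightarrow> 0 \<le> h i"
        using h(1) by (auto simp: G_def int_cone_def)
      define z where "z = (\<lambda>i. y i - h i)"
      have "z \<in> int_cone I u"
        using h by (simp add: z_def int_cone_def right_diff_distrib sum_subtractf)
      \<comment> \<open>The entries of \<open>h\<close> are nonnegative and not all zero. Since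
        \<open>h \<le> y\<close> on \<open>I\<close>, the entry sum of \<open>y\<close> is positive
        too, so \<open>nat\<close> preserves the strict decrease.\<close>
      moreover have "0 < (\<Sum>i\<in>I. h i)"
        using h(2) h0 I by (metis order_le_less sum_nonneg sum_nonneg_eq_0_iff)
      then have "nat (\<Sum>i\<in>I. z i) < nat (\<Sum>i\<in>I. y i)"
        using sum_mono[of I h y] h(3) by (simp add: z_def sum_subtractf)
      ultimately obtain c :: "_ \<Rightarrow> nat" where c: "\<forall>i\<in>I. z i = (\<Sum>g\<in>G. int (c g) * g i)"
        using less.hyps by blast
      have "y i = (\<Sum>g\<in>G. int ((c(h := Suc (c h))) g) * g i)" if "i \<in> I" for i
      proof -
        have "(\<Sum>g\<in>G. int ((c(h := Suc (c h))) g) * g i)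
            = (\<Sum>g\<in>G. int (c g) * g i + (if g = h then h i else 0))"
          by (rule sum.cong) (auto simp: algebra_simps)
        also have "\<dots> = z i + h i"
          using c that h(1) finG by (simp add: sum.distrib)
        finally show ?thesis by (simp add: z_def)
      qed
      then show ?thesis
        by (intro exI[of _ "c(h := Suc (c h))"] ballI)
    qed
  qed
  show thesis
    by (rule that[OF finG _ gen]) (auto simp: G_def PiE_iff)
qed

section \<open>The po-ring structure on a subring of the rationals\<close>

lemma ring_rat_po_ring: "ring rat_po_ring"
proof (rule ringI)
  show "abelian_group rat_po_ring"
  proof (rule abelian_groupI)
    show "\<exists>y\<in>carrier rat_po_ring. y \<oplus>\<^bsub>rat_po_ring\<^esub> x = \<zero>\<^bsub>rat_po_ring\<^esub>" for x
      by (auto simp: rat_po_ring_def intro: exI[of _ "- x"])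
  qed (auto simp: rat_po_ring_def)
  show "Group.monoid rat_po_ring"
    by (rule monoidI) (auto simp: rat_po_ring_def)
qed (auto simp: rat_po_ring_def algebra_simps)

locale rat_subring =
  fixes S :: "rat set" and R :: "rat po_ring"
  assumes subring: "subring S rat_po_ring"
  defines "R \<equiv> rat_po_ring\<lparr>carrier := S\<rparr>"
begin

lemma R_simps [simp]:
  "carrier R = S" "mult R = (*)" "one R = 1" "zero R = 0" "add R = (+)" "ple R = (\<le>)"
  by (auto simp: R_def rat_po_ring_def)

lemma ring_R: "ring R"
  unfolding R_def by (rule ring.subring_is_ring[OF ring_rat_po_ring subring])

sublocale ring R
  by (rule ring_R)

lemma S_closed [simp]:
  "0 \<in> S" "1 \<in> S" "x \<in> S \<Longrightarrow> y \<in> S \<Longrightarrow> x + y \<in> S" "x \<in> S \<Longrightarrow> y \<in> S \<Longrightarrow> x * y \<in> S"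
  using zero_closed one_closed a_closed[of x y] m_closed[of x y] by simp_all

lemma a_inv_R: "x \<in> S \<Longrightarrow> \<ominus>\<^bsub>R\<^esub> x = - x"
  using r_neg[of x] by simp

lemma S_uminus [simp]: "x \<in> S \<Longrightarrow> - x \<in> S"
  using a_inv_closed[of x] a_inv_R[of x] by simp

lemma of_nat_S [simp]: "of_nat n \<in> S"
  by (induction n) auto

lemma of_int_S [simp]: "of_int z \<in> S"
  by (cases z) (auto simp del: of_nat_Suc)

lemma sum_S: "(\<And>a. a \<in> A \<Longrightarrow> f a \<in> S) \<Longrightarrow> sum f A \<in> S"
  by (induction A rule: infinite_finite_induct) auto

lemma nonneg_R: "nonneg R = {x \<in> S. 0 \<le> x}"
  by (simp add: nonneg_def)

lemma finsum_R:
  assumes "finite A" "\<And>a. a \<in> A \<Longrightarrow> f a \<in> S"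
  shows "(\<Oplus>\<^bsub>R\<^esub>a\<in>A. f a) = (\<Sum>a\<in>A. f a)"
  using assms
proof (induction rule: finite_induct)
  case (insert a A)
  then have "f \<in> A \<rightarrow> carrier R" "f a \<in> carrier R" by auto
  with insert show ?case by simp
qed (simp add: finsum_empty[simplified])

lemma po_ring_R: "po_ring R"
proof (intro po_ring.intro po_ring_axioms.intro ring_R)
  \<comment> \<open>Directedness comes from totality of the order: write \<open>x\<close> as
    \<open>x - 0\<close> or as \<open>0 - (- x)\<close>.\<close>
  show "\<exists>a\<in>nonneg R. \<exists>b\<in>nonneg R. x = a \<oplus>\<^bsub>R\<^esub> \<ominus>\<^bsub>R\<^esub> b" if "x \<in> carrier R" for x
  proof (cases "0 \<le> x")
    case True
    then show ?thesis
      using that a_inv_R[of 0] by (intro bexI[of _ x] bexI[of _ 0]) (auto simp: nonneg_R)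
  next
    case False
    then show ?thesis
      using that a_inv_R[of "- x"] by (intro bexI[of _ 0] bexI[of _ "- x"]) (auto simp: nonneg_R)
  qed
qed (auto simp: nonneg_R mult_right_mono mult_left_mono)

section \<open>Denominators that are invertible in \<open>S\<close>\<close>

lemma inverse_denominator_S:
  assumes "x \<in> S"
  obtains d :: int where "0 < d" "1 / of_int d \<in> S" "x * of_int d \<in> \<int>"
proof -
  obtain a b where ab: "x = of_int a / of_int b" "0 < b" "coprime a b"
    by (cases x) (simp add: Fract_of_int_quotient)
  \<comment> \<open>Dividing the Bezout identity by \<open>b\<close> gives
    \<open>p * x + q = 1 / b\<close>, and the left side lies in \<open>S\<close> because
    \<open>S\<close> contains the integers.\<close>
  obtain p q where "p * a + q * b = 1"
    using bezout_int[of a b] ab(3) by auto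
  then have "of_int p * of_int a + of_int q * of_int b = (1 :: rat)"
    by (metis of_int_1 of_int_add of_int_mult)
  then have "of_int p * x + of_int q = 1 / of_int b"
    using ab(2) by (simp add: ab(1) field_simps)
  moreover have "of_int p * x + of_int q \<in> S"
    using assms by simp
  ultimately show thesis
    using that[of b] ab by simp
qed

text \<open>The product of the denominators of the entries works, its inverse being a product of
  elements of \<open>S\<close>. Clearing denominators by \<open>d\<close> can therefore be undone
  inside \<open>S\<close>.\<close>

lemma common_denominator_S:
  assumes "finite I" "\<And>i. i \<in> I \<Longrightarrow> x i \<in> S"
  obtains d :: int where "0 < d" "1 / of_int d \<in> S" "\<And>i. i \<in> I \<Longrightarrow> x i * of_int d \<in> \<int>"
proof -
  have "\<exists>d :: int. 0 < d \<and> 1 / of_int d \<in> S \<and> (\<forall>i\<in>I. x i * of_int d \<in> \<int>)"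
    using assms
  proof (induction rule: finite_induct)
    case empty
    then show ?case by (intro exI[of _ 1]) auto
  next
    case (insert a I)
    then obtain d :: int where d: "0 < d" "1 / of_int d \<in> S" "\<forall>i\<in>I. x i * of_int d \<in> \<int>"
      by auto
    obtain e :: int where e: "0 < e" "1 / of_int e \<in> S" "x a * of_int e \<in> \<int>"
      using inverse_denominator_S[of "x a"] insert.prems by auto
    have "x i * of_int (d * e) \<in> \<int>" if "i \<in> insert a I" for i
    proof (cases "i = a")
      case True
      then show ?thesis
        using Ints_mult[OF e(3) Ints_of_int[of d]] by (simp add: algebra_simps)
    next
      case False
      then have "x i * of_int d \<in> \<int>" using d(3) that by auto
      then have "x i * of_int d * of_int e \<in> \<int>" by simp
      then show ?thesis by (simp add: mult.assoc)
    qed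
    moreover have "1 / of_int (d * e) \<in> S"
      using S_closed(4)[OF d(2) e(2)] by simp
    ultimately show ?case
      using d(1) e(1) by (intro exI[of _ "d * e"]) auto
  qed
  then show thesis using that by blast
qed

section \<open>Finite generation of the solution set over \<open>S\<close>\<close>

definition cone :: "nat \<Rightarrow> (nat \<Rightarrow> rat) \<Rightarrow> (nat \<Rightarrow> rat) set"
  where "cone n U = {X \<in> {..<n} \<rightarrow>\<^sub>E S. 0 \<le> (\<Sum>i<n. U i * X i) \<and> (\<forall>i<n. 0 \<le> X i)}"

lemma right_subsemimodule_cone: "right_subsemimodule R n (cone n U)"
proof -
  have "(\<lambda>i\<in>{..<n}. X i + Y i) \<in> cone n U" if "X \<in> cone n U" "Y \<in> cone n U" for X Y
    using that by (auto simp: cone_def PiE_iff algebra_simps sum.distrib)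
  moreover have "(\<lambda>i\<in>{..<n}. X i * c) \<in> cone n U" if "X \<in> cone n U" "c \<in> nonneg R" for X c
    using that
    by (auto simp: cone_def nonneg_R PiE_iff simp flip: mult.assoc sum_distrib_right)
  ultimately show ?thesis
    by (auto simp: right_subsemimodule_def add_submonoid_def vecs_def cone_def)
qed

lemma right_combinations_R:
  assumes "finite G" "G \<subseteq> {..<n} \<rightarrow>\<^sub>E S"
  shows "right_combinations R n G
    = {\<lambda>i\<in>{..<n}. \<Sum>g\<in>G. g i * c g | c. c \<in> G \<rightarrow> {x \<in> S. 0 \<le> x}}"
proof -
  have "(\<lambda>i\<in>{..<n}. \<Oplus>\<^bsub>R\<^esub>g\<in>G. g i * c g) = (\<lambda>i\<in>{..<n}. \<Sum>g\<in>G. g i * c g)"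
    if "c \<in> G \<rightarrow> {x \<in> S. 0 \<le> x}" for c
  proof (rule restrict_ext)
    fix i assume "i \<in> {..<n}"
    then show "(\<Oplus>\<^bsub>R\<^esub>g\<in>G. g i * c g) = (\<Sum>g\<in>G. g i * c g)"
      using assms that by (intro finsum_R S_closed) (auto simp: PiE_iff)
  qed
  then show ?thesis
    unfolding right_combinations_def nonneg_R R_simps
    by (intro Collect_cong ex_cong1 rev_conj_cong refl) simp_all
qed

lemma right_combinations_subset_cone:
  assumes "finite G" "G \<subseteq> cone n U"
  shows "right_combinations R n G \<subseteq> cone n U"
proof -
  have G: "G \<subseteq> {..<n} \<rightarrow>\<^sub>E S"
    using assms(2) by (auto simp: cone_def)
  have "(\<lambda>i\<in>{..<n}. \<Sum>g\<in>G. g i * c g) \<in> cone n U" if c: "c \<in> G \<rightarrow> {x \<in> S. 0 \<le> x}" for c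
  proof -
    have "(\<Sum>g\<in>G. g i * c g) \<in> S" if "i < n" for i
      using G c that by (intro sum_S S_closed) (auto simp: PiE_iff)
    moreover have "0 \<le> (\<Sum>g\<in>G. g i * c g)" if "i < n" for i
      using assms(2) c that by (intro sum_nonneg mult_nonneg_nonneg) (auto simp: cone_def)
    moreover have "0 \<le> (\<Sum>i<n. U i * (\<Sum>g\<in>G. g i * c g))"
    proof -
      \<comment> \<open>Exchanging the sums exhibits the value at a combination as the same
        combination of the values at the generators, which are nonnegative.\<close>
      have "(\<Sum>i<n. U i * (\<Sum>g\<in>G. g i * c g)) = (\<Sum>g\<in>G. (\<Sum>i<n. U i * g i) * c g)"
        unfolding sum_distrib_left sum_distrib_right mult.assoc by (rule sum.swap)
      also have "\<dots> \<ge> 0"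
        using assms(2) c by (intro sum_nonneg[of G] mult_nonneg_nonneg) (auto simp: cone_def)
      finally show ?thesis .
    qed
    ultimately show ?thesis by (simp add: cone_def)
  qed
  then show ?thesis
    by (auto simp: right_combinations_R[OF assms(1) G])
qed

text \<open>The images of the integer generators serve every \<open>X\<close> at once: the
  denominator \<open>d\<close> depends on \<open>X\<close>, but it enters only the
  coefficients.\<close>

lemma fg_cone:
  assumes U: "U \<in> {..<n} \<rightarrow>\<^sub>E S"
  shows "fg_right_subsemimodule R n (cone n U)"
proof -
  let ?I = "{..<n}"
  obtain D :: int where D: "0 < D" "\<And>i. i \<in> ?I \<Longrightarrow> U i * of_int D \<in> \<int>"
    by (rule common_denominator_S[of ?I U]) (use U in auto)
  \<comment> \<open>The floor only changes the type: for \<open>i < n\<close> its argument is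
    already an integer, so nothing is rounded.\<close>
  define u where "u = (\<lambda>i. \<lfloor>U i * of_int D\<rfloor>)"
  have u: "of_int (u i) = U i * of_int D" if "i < n" for i
    using D(2)[of i] that by (simp add: u_def)
  \<comment> \<open>As \<open>D\<close> is positive, the integer inequality for \<open>u\<close> and
    the rational one for \<open>U\<close> hold for the same integer vectors.\<close>
  have sum_u: "of_int (\<Sum>i<n. u i * y i) = of_int D * (\<Sum>i<n. U i * of_int (y i))" for y
    by (simp add: u sum_distrib_left algebra_simps)
  obtain G where G: "finite G" "G \<subseteq> int_cone ?I u \<inter> extensional ?I"
    and gen: "\<And>y. y \<in> int_cone ?I u \<Longrightarrow> \<exists>c :: _ \<Rightarrow> nat. \<forall>i\<in>?I. y i = (\<Sum>g\<in>G. int (c g) * g i)"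
    using int_cone_finitely_generated[of ?I u] by auto
  define \<iota> where "\<iota> y = (\<lambda>i\<in>?I. of_int (y i) :: rat)" for y
  \<comment> \<open>A left inverse of \<open>\<iota>\<close> on \<open>G\<close>, where
    extensionality settles the values outside the index set. It carries coefficients indexed by
    \<open>G\<close> over to the image of \<open>G\<close>.\<close>
  define \<phi> where "\<phi> X = (\<lambda>i\<in>?I. \<lfloor>X i\<rfloor>)" for X :: "nat \<Rightarrow> rat"
  have \<phi>\<iota>: "\<phi> (\<iota> g) = g" if "g \<in> G" for g
    using G(2) that by (auto simp: \<phi>_def \<iota>_def extensional_def restrict_def fun_eq_iff)
  have \<iota>_cone: "\<iota> y \<in> cone n U" if "y \<in> int_cone ?I u" for y
  proof -
    have "0 \<le> (\<Sum>i<n. u i * y i)"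
      using that by (simp add: int_cone_def)
    then have "0 \<le> of_int D * (\<Sum>i<n. U i * of_int (y i))"
      unfolding sum_u[symmetric] by (simp only: of_int_0_le_iff)
    then show ?thesis
      using that D(1) by (auto simp: \<iota>_def cone_def int_cone_def zero_le_mult_iff)
  qed
  have H: "finite (\<iota> ` G)" "\<iota> ` G \<subseteq> cone n U"
    using G \<iota>_cone by auto
  have "X \<in> right_combinations R n (\<iota> ` G)" if X: "X \<in> cone n U" for X
  proof -
    obtain d :: int where d: "0 < d" "1 / of_int d \<in> S" "\<And>i. i \<in> ?I \<Longrightarrow> X i * of_int d \<in> \<int>"
      by (rule common_denominator_S[of ?I X]) (use X in \<open>auto simp: cone_def\<close>)
    define y where "y = (\<lambda>i. \<lfloor>X i * of_int d\<rfloor>)"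
    have y: "of_int (y i) = X i * of_int d" if "i < n" for i
      using d(3)[of i] that by (simp add: y_def)
    have "y \<in> int_cone ?I u"
    proof -
      have "of_int (\<Sum>i<n. u i * y i) = of_int D * of_int d * (\<Sum>i<n. U i * X i)"
        unfolding sum_u by (simp add: y sum_distrib_left algebra_simps)
      also have "\<dots> \<ge> 0"
        using X D(1) d(1) by (intro mult_nonneg_nonneg) (auto simp: cone_def)
      finally have "0 \<le> (\<Sum>i<n. u i * y i)" by (simp only: of_int_0_le_iff)
      moreover have "0 \<le> y i" if "i < n" for i
        using X d(1) that by (simp add: y_def cone_def)
      ultimately show ?thesis by (simp add: int_cone_def)
    qed
    then obtain c :: "_ \<Rightarrow> nat" where c: "\<forall>i\<in>?I. y i = (\<Sum>g\<in>G. int (c g) * g i)"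
      using gen by blast
    \<comment> \<open>The factor \<open>1 / d\<close> undoes the scaling from \<open>X\<close> to
      \<open>y\<close>; since it lies in \<open>S\<close>, the new coefficients are nonnegative
      elements of \<open>S\<close>.\<close>
    define c' where "c' h = of_nat (c (\<phi> h)) * (1 / of_int d :: rat)" for h
    have "X = (\<lambda>i\<in>?I. \<Sum>h\<in>\<iota> ` G. h i * c' h)"
    proof
      fix i
      show "X i = (\<lambda>i\<in>?I. \<Sum>h\<in>\<iota> ` G. h i * c' h) i"
      proof (cases "i < n")
        case True
        have "(\<Sum>h\<in>\<iota> ` G. h i * c' h) = (\<Sum>g\<in>G. \<iota> g i * c' (\<iota> g))"
          using \<phi>\<iota> by (intro sum.reindex_cong[of \<iota>]) (auto intro: inj_on_inverseI)
        also have "\<dots> = (\<Sum>g\<in>G. of_int (int (c g) * g i) / of_int d)"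
          using True by (intro sum.cong) (auto simp: c'_def \<phi>\<iota>, simp add: \<iota>_def)
        also have "\<dots> = of_int (y i) / of_int d"
          using c True by (simp add: sum_divide_distrib)
        also have "\<dots> = X i"
          using y[OF True] d(1) by simp
        finally show ?thesis using True by simp
      next
        case False
        then show ?thesis using X by (auto simp: cone_def PiE_iff extensional_def)
      qed
    qed
    moreover have "c' \<in> \<iota> ` G \<rightarrow> {x \<in> S. 0 \<le> x}"
      using d(1) S_closed(4)[OF of_nat_S d(2)] by (auto simp: c'_def)
    moreover have "\<iota> ` G \<subseteq> ?I \<rightarrow>\<^sub>E S"
      using H(2) by (auto simp: cone_def)
    ultimately show ?thesis
      unfolding right_combinations_R[OF H(1) \<open>\<iota> ` G \<subseteq> ?I \<rightarrow>\<^sub>E S\<close>] by blast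
  qed
  then have "cone n U = right_combinations R n (\<iota> ` G)"
    using right_combinations_subset_cone[OF H] by blast
  then show ?thesis
    using right_subsemimodule_cone H unfolding fg_right_subsemimodule_def by blast
qed

section \<open>Right and left po-coherence\<close>

lemma right_po_coherent_R: "right_po_coherent R"
proof -
  \<comment> \<open>This identifies the solution set with \<open>cone\<close>, replacing the ring's
    finite sum by the ordinary one.\<close>
  have "{X \<in> vecs R n. 0 \<le> row_col_mult R n U X \<and> (\<forall>i<n. 0 \<le> X i)} = cone n U"
    if U: "U \<in> {..<n} \<rightarrow>\<^sub>E S" for n U
  proof -
    have "row_col_mult R n U X = (\<Sum>i<n. U i * X i)" if "X \<in> {..<n} \<rightarrow>\<^sub>E S" for X
      using U that finsum_R[of "{..<n}" "\<lambda>i. U i * X i"] by (auto simp: row_col_mult_def PiE_iff)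
    then show ?thesis
      by (auto simp: vecs_def cone_def)
  qed
  then show ?thesis
    using fg_cone po_ring_R by (simp add: right_po_coherent_def) (simp add: vecs_def)
qed

text \<open>Multiplication of rationals commutes, so the left-hand notions over \<open>R\<close>
  coincide with the right-hand ones.\<close>

lemma left_po_coherent_R: "left_po_coherent R"
proof -
  have "fg_left_subsemimodule R = fg_right_subsemimodule R"
    by (simp add: fun_eq_iff fg_left_subsemimodule_def fg_right_subsemimodule_def
        left_subsemimodule_def right_subsemimodule_def left_combinations_def
        right_combinations_def mult.commute)
  moreover have "row_col_mult R n X U = row_col_mult R n U X" for n X U
    by (simp add: row_col_mult_def mult.commute)
  ultimately show ?thesis
    using right_po_coherent_R by (simp add: left_po_coherent_def right_po_coherent_def)
qed

end

theorem theorem6p4: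
  fixes S :: "rat set"
  assumes "subring S rat_po_ring"
  shows "po_coherent (rat_po_ring\<lparr>carrier := S\<rparr>)"
  using assms
  by (simp add: po_coherent_def rat_subring.right_po_coherent_R rat_subring.left_po_coherent_R
      rat_subring.intro)

end
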